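(* Let $n\ge1$ be an integer and let $a_1<a_2<\dots<a_n$ be natural numbers (positive integers). For $k\in\mathbb N=\{1,2,\dots\}$ let $\Delta_2(k)$ be the determinant defined in the context. Then, up to sign, $\Delta_2(k)$ does not depend on $k$, and it is nonzero; that is, there is a nonzero constant $C$ (independent of $k$) such that $\Delta_2(k)\in\{C,-C\}$ for all $k\in\mathbb N$.
   Context: The determinant $\Delta_2(k)$. For $k\in\mathbb N$, $$\Delta_2(k)=\left(-\frac i2\right)^n\det\left[p_1,\dots,p_n,q_1^+,q_1^-,q_2^+,q_2^-,\dots,q_n^+,q_n^-\right],$$ the determinant of a $3n\times3n$ complex matrix whose columns are as follows. The first $n$ entries of a column are indexed by $m=0,\dots,n-1$ and the last $2n$ entries by $t=0,\dots,2n-1$. The column $p_s$ has entries $0$ (for each $m$) and $(-a_s)^t$ (for each $t$); the column $q_s^{+}$ has entries $a_s^{2m}e^{-i\pi k a_s}$ and $(ia_s)^t$; the column $q_s^{-}$ has entries $a_s^{2m}e^{i\pi k a_s}$ and $(-ia_s)^t$. Here $i$ is the imaginary unit. *)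

theory Defs
  imports Complex_Main "Jordan_Normal_Form.Determinant"
begin

text \<open>
  The columns depend on \<open>s\<close> only through \<open>x = a s\<close>.
  The upper block of \<open>n\<close> entries is indexed by \<open>m < n\<close>, the lower block of \<open>2 * n\<close> entries
  by \<open>t < 2 * n\<close>.
\<close>

definition p_col :: "nat \<Rightarrow> nat \<Rightarrow> complex vec" where
  "p_col n x = vec n (\<lambda>m. 0) @\<^sub>v vec (2 * n) (\<lambda>t. (- of_nat x) ^ t)"

definition q_plus_col :: "nat \<Rightarrow> nat \<Rightarrow> nat \<Rightarrow> complex vec" where
  "q_plus_col n k x =
     vec n (\<lambda>m. of_nat x ^ (2 * m) * exp (- (\<i> * of_real pi * of_nat k * of_nat x)))
     @\<^sub>v vec (2 * n) (\<lambda>t. (\<i> * of_nat x) ^ t)"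

definition q_minus_col :: "nat \<Rightarrow> nat \<Rightarrow> nat \<Rightarrow> complex vec" where
  "q_minus_col n k x =
     vec n (\<lambda>m. of_nat x ^ (2 * m) * exp (\<i> * of_real pi * of_nat k * of_nat x))
     @\<^sub>v vec (2 * n) (\<lambda>t. (- (\<i> * of_nat x)) ^ t)"

definition Delta2_mat :: "nat \<Rightarrow> (nat \<Rightarrow> nat) \<Rightarrow> nat \<Rightarrow> complex mat" where
  "Delta2_mat n a k =
     mat_of_cols (3 * n)
       (map (\<lambda>s. p_col n (a s)) [1..<n + 1] @
        concat (map (\<lambda>s. [q_plus_col n k (a s), q_minus_col n k (a s)]) [1..<n + 1]))"

definition Delta2 :: "nat \<Rightarrow> (nat \<Rightarrow> nat) \<Rightarrow> nat \<Rightarrow> complex" where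
  "Delta2 n a k = (- (\<i> / 2)) ^ n * det (Delta2_mat n a k)"

lemma Delta2_mat_carrier: "Delta2_mat n a k \<in> carrier_mat (3 * n) (3 * n)"
proof -
  have "length (concat (map (\<lambda>s. [q_plus_col n k (a s), q_minus_col n k (a s)]) xs)) = 2 * length xs"
    for xs :: "nat list"
    by (induction xs) auto
  then show ?thesis
    by (intro carrier_matI) (simp_all add: Delta2_mat_def del: upt_Suc length_concat)
qed

end

(* Since exp(+-i pi k a_s) = (-1)^(k a_s), the upper block of both q_s columns is the even Vandermonde
   column of a_s times a sign e_s.  Some matrix A with A^2 = 1 multiplies each even Vandermonde
   column by its sign e_s, and diag(A, 1) maps the matrix for 0 to the matrix for k, so that
   passing from 0 to k multiplies the determinant by det A = 1 or -1.

   The matrix for 0 is regular: a vector in its left kernel consists of polynomials Q (degree < n)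
   and P (degree < 2n) with P(-a_s) = 0 and Q(a_s^2) + P(i a_s) = Q(a_s^2) + P(-i a_s) = 0.
   The odd part of P then vanishes at n values of x^2, so it is zero; P(-a_s) = 0 kills the
   even part in the same way, and finally Q = 0. *)

theory Submission
  imports Defs
begin

section \<open>Polynomial identities and matrices given by their columns\<close>

lemma sum_powers_eq_0_imp_coeff_eq_0:
  fixes c :: "nat \<Rightarrow> complex"
  assumes inj: "inj_on y S" and card: "card S = n"
    and root: "\<And>s. s \<in> S \<Longrightarrow> (\<Sum>m<n. c m * y s ^ m) = 0"
    and "m < n"
  shows "c m = 0"
proof (rule ccontr)
  assume "c m \<noteq> 0"
  obtain N where n: "n = Suc N" using \<open>m < n\<close> by (cases n) auto
  let ?R = "{z. (\<Sum>i\<le>N. c i * z ^ i) = 0}"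
  \<comment> \<open>A nonzero coefficient allows at most \<open>N = n - 1\<close> roots, while the
    injective \<open>y\<close> supplies \<open>n\<close> of them.\<close>
  have "finite ?R \<and> card ?R \<le> N"
    using polyfun_rootbound[of c m N] \<open>c m \<noteq> 0\<close> \<open>m < n\<close> n by simp
  moreover have "y ` S \<subseteq> ?R"
    using root by (auto simp: n lessThan_Suc_atMost)
  ultimately have "card (y ` S) \<le> N"
    by (meson card_mono order_trans)
  then show False using card_image[OF inj] card n by simp
qed

lemma sum_even_odd_split:
  fixes x :: "'a :: comm_ring_1"
  shows "(\<Sum>t<2 * n. d t * x ^ t) =
    (\<Sum>m<n. d (2 * m) * (x^2) ^ m) + x * (\<Sum>m<n. d (2 * m + 1) * (x^2) ^ m)"
  by (induction n) (simp_all add: algebra_simps power_mult [symmetric])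

lemma append_vec_scalar_prod:
  assumes "v \<in> carrier_vec (n + p)"
  shows "(vec n f @\<^sub>v vec p g) \<bullet> v = (\<Sum>m<n. f m * v $ m) + (\<Sum>t<p. g t * v $ (n + t))"
proof -
  have v: "v = vec n (\<lambda>m. v $ m) @\<^sub>v vec p (\<lambda>t. v $ (n + t))"
    using assms by (intro eq_vecI) auto
  have "(vec n f @\<^sub>v vec p g) \<bullet> v
      = vec n f \<bullet> vec n (\<lambda>m. v $ m) + vec p g \<bullet> vec p (\<lambda>t. v $ (n + t))"
    by (subst v, rule scalar_prod_append) auto
  then show ?thesis
    by (simp add: scalar_prod_def atLeast0LessThan)
qed

text \<open>A singular matrix has a singular transpose, whose kernel consists of the vectors
  orthogonal to all columns. In this form the kernel conditions become evaluations of polynomials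
  with coefficient vector \<open>v\<close>.\<close>

lemma det_mat_of_cols_neq_0I:
  fixes cs :: "'a :: field vec list"
  assumes len: "length cs = N" and cs: "set cs \<subseteq> carrier_vec N"
    and ker: "\<And>v. v \<in> carrier_vec N \<Longrightarrow> (\<And>c. c \<in> set cs \<Longrightarrow> c \<bullet> v = 0) \<Longrightarrow> v = 0\<^sub>v N"
  shows "det (mat_of_cols N cs) \<noteq> 0"
proof
  assume "det (mat_of_cols N cs) = 0"
  moreover have carr: "mat_of_cols N cs \<in> carrier_mat N N" using len by auto
  ultimately have "det (transpose_mat (mat_of_cols N cs)) = 0"
    by (simp add: det_transpose)
  moreover have "transpose_mat (mat_of_cols N cs) \<in> carrier_mat N N" using carr by simp
  ultimately obtain v where v: "v \<in> carrier_vec N" "v \<noteq> 0\<^sub>v N"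
    and z: "transpose_mat (mat_of_cols N cs) *\<^sub>v v = 0\<^sub>v N"
    using det_0_iff_vec_prod_zero_field by blast
  have "c \<bullet> v = 0" if c: "c \<in> set cs" for c
  proof -
    obtain j where j: "j < N" "c = cs ! j"
      using c len by (auto simp: in_set_conv_nth)
    have "(transpose_mat (mat_of_cols N cs) *\<^sub>v v) $ j = c \<bullet> v"
      using j len cs by (subst index_mult_mat_vec) (auto simp: subset_code(1))
    then show ?thesis using z j by simp
  qed
  then show False using ker v by blast
qed

lemma mult_mat_of_cols:
  assumes T: "T \<in> carrier_mat N N" and cs: "set cs \<subseteq> carrier_vec N"
  shows "T * mat_of_cols N cs = mat_of_cols N (map (\<lambda>c. T *\<^sub>v c) cs)"
proof (rule mat_col_eqI)
  fix j assume "j < dim_col (mat_of_cols N (map (\<lambda>c. T *\<^sub>v c) cs))"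
  then have j: "j < length cs" by simp
  have cj: "cs ! j \<in> carrier_vec N" using cs j by auto
  have "col (T * mat_of_cols N cs) j = T *\<^sub>v col (mat_of_cols N cs) j"
    by (rule col_mult2[OF T]) (use j in auto)
  then show "col (T * mat_of_cols N cs) j = col (mat_of_cols N (map (\<lambda>c. T *\<^sub>v c) cs)) j"
    using j cj T by simp
qed (use T in auto)

section \<open>The exponentials as signs, and the resulting form of the columns\<close>

lemma exp_i_pi_times_nat:
  "exp (\<i> * of_real pi * of_nat k * of_nat x) = ((-1) ^ (k * x) :: complex)"
  "exp (- (\<i> * of_real pi * of_nat k * of_nat x)) = ((-1) ^ (k * x) :: complex)"
proof -
  have "exp (\<i> * of_real pi * of_nat k * of_nat x) = exp (of_nat (k * x) * (\<i> * of_real pi))"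
    by (simp add: ac_simps)
  also have "\<dots> = (-1) ^ (k * x)"
    by (subst exp_of_nat_mult) (simp add: mult.commute[of \<i>])
  finally show *: "exp (\<i> * of_real pi * of_nat k * of_nat x) = ((-1) ^ (k * x) :: complex)" .
  show "exp (- (\<i> * of_real pi * of_nat k * of_nat x)) = ((-1) ^ (k * x) :: complex)"
    \<comment> \<open>A power of -1 is its own inverse, so both \<open>q\<close> columns for
      \<open>x\<close> have the same upper block.\<close>
    unfolding exp_minus * by (simp flip: power_inverse)
qed

definition even_power_vec :: "nat \<Rightarrow> nat \<Rightarrow> complex vec" where
  "even_power_vec n x = vec n (\<lambda>m. of_nat x ^ (2 * m))"

lemma even_power_vec_carrier [simp]: "even_power_vec n x \<in> carrier_vec n"
  by (simp add: even_power_vec_def)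

lemma p_col_alt: "p_col n x = 0\<^sub>v n @\<^sub>v vec (2 * n) (\<lambda>t. (- of_nat x) ^ t)"
  by (simp add: p_col_def zero_vec_def)

text \<open>Isolates the dependence on \<open>k\<close> as a scalar in the upper block, where a
  block-diagonal matrix can produce it.\<close>

lemma q_plus_col_alt:
  "q_plus_col n k x = (-1) ^ (k * x) \<cdot>\<^sub>v even_power_vec n x @\<^sub>v vec (2 * n) (\<lambda>t. (\<i> * of_nat x) ^ t)"
  unfolding q_plus_col_def exp_i_pi_times_nat even_power_vec_def
  by (intro arg_cong2[of _ _ _ _ append_vec] eq_vecI) auto

lemma q_minus_col_alt:
  "q_minus_col n k x =
    (-1) ^ (k * x) \<cdot>\<^sub>v even_power_vec n x @\<^sub>v vec (2 * n) (\<lambda>t. (- (\<i> * of_nat x)) ^ t)"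
  unfolding q_minus_col_def exp_i_pi_times_nat even_power_vec_def
  by (intro arg_cong2[of _ _ _ _ append_vec] eq_vecI) auto

lemma columns_carrier:
  "p_col n x \<in> carrier_vec (3 * n)"
  "q_plus_col n k x \<in> carrier_vec (3 * n)"
  "q_minus_col n k x \<in> carrier_vec (3 * n)"
  unfolding p_col_def q_plus_col_def q_minus_col_def carrier_dim_vec index_append_vec dim_vec
  by simp_all

section \<open>Regularity and change of sign for distinct positive \<open>a s\<close>\<close>

context
  fixes n :: nat and a :: "nat \<Rightarrow> nat"
  assumes pos: "\<And>s. s \<in> {1..n} \<Longrightarrow> a s \<ge> 1"
    and inj: "inj_on a {1..n}"
begin

lemma inj_on_squares: "inj_on (\<lambda>s. (of_nat (a s))\<^sup>2 :: complex) {1..n}"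
proof (rule inj_onI)
  fix s t assume st: "s \<in> {1..n}" "t \<in> {1..n}"
  assume "(of_nat (a s))\<^sup>2 = ((of_nat (a t))\<^sup>2 :: complex)"
  then have "a s ^ 2 = a t ^ 2"
    by (metis of_nat_eq_iff of_nat_power)
  then have "a s = a t" by simp
  then show "s = t" using inj st by (auto dest: inj_onD)
qed

lemma coeff_eq_0_if_roots_squares:
  fixes c :: "nat \<Rightarrow> complex"
  assumes "\<And>s. s \<in> {1..n} \<Longrightarrow> (\<Sum>m<n. c m * ((of_nat (a s))\<^sup>2) ^ m) = 0" and "m < n"
  shows "c m = 0"
  by (rule sum_powers_eq_0_imp_coeff_eq_0[OF inj_on_squares _ assms]) simp_all

text \<open>Moving the minus sign into the coefficients reduces this to the positive squares.
  Negative squares arise from evaluating at \<open>\<i> * a s\<close> and its negative.\<close>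

lemma coeff_eq_0_if_roots_neg_squares:
  fixes c :: "nat \<Rightarrow> complex"
  assumes "\<And>s. s \<in> {1..n} \<Longrightarrow> (\<Sum>m<n. c m * (- (of_nat (a s))\<^sup>2) ^ m) = 0" and "m < n"
  shows "c m = 0"
proof -
  have "(-1) ^ m * c m = 0"
  proof (rule coeff_eq_0_if_roots_squares[OF _ assms(2)])
    fix s assume "s \<in> {1..n}"
    from assms(1)[OF this] show "(\<Sum>m<n. (-1) ^ m * c m * ((of_nat (a s))\<^sup>2) ^ m) = 0"
      by (subst (asm) power_minus) (simp add: ac_simps)
  qed
  then show ?thesis by simp
qed

lemma det_even_power_mat_neq_0:
  "det (mat_of_cols n (map (\<lambda>s. even_power_vec n (a s)) [1..<n + 1])) \<noteq> 0"
proof (rule det_mat_of_cols_neq_0I)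
  fix v :: "complex vec" assume v: "v \<in> carrier_vec n"
    and orth: "\<And>c. c \<in> set (map (\<lambda>s. even_power_vec n (a s)) [1..<n + 1]) \<Longrightarrow> c \<bullet> v = 0"
  have root: "(\<Sum>m<n. v $ m * ((of_nat (a s))\<^sup>2) ^ m) = 0" if "s \<in> {1..n}" for s
  proof -
    have "even_power_vec n (a s) \<bullet> v = 0" using that by (intro orth) (auto simp del: upt_Suc)
    then show ?thesis
      using v by (simp add: even_power_vec_def scalar_prod_def atLeast0LessThan
          power_mult mult.commute[of _ "v $ _"])
  qed
  have "v $ m = 0" if "m < n" for m
    using coeff_eq_0_if_roots_squares[of "\<lambda>m. v $ m", OF root that] by simp
  then show "v = 0\<^sub>v n" using v by (intro eq_vecI) auto
qed auto

text \<open>The value \<open>k = 0\<close> lies outside the range of the theorem but is a convenient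
  base point, since all signs are 1 there.\<close>

lemma det_Delta2_mat_0_neq_0: "det (Delta2_mat n a 0) \<noteq> 0"
  unfolding Delta2_mat_def
proof (rule det_mat_of_cols_neq_0I)
  let ?cs = "map (\<lambda>s. p_col n (a s)) [1..<n + 1] @
    concat (map (\<lambda>s. [q_plus_col n 0 (a s), q_minus_col n 0 (a s)]) [1..<n + 1])"
  show "length ?cs = 3 * n"
    using carrier_matD(2)[OF Delta2_mat_carrier[of n a 0]]
    by (simp only: Delta2_mat_def mat_of_cols_carrier)
  show "set ?cs \<subseteq> carrier_vec (3 * n)"
    by (auto simp: columns_carrier simp del: upt_Suc)
  fix v :: "complex vec" assume v: "v \<in> carrier_vec (3 * n)"
    and orth: "\<And>c. c \<in> set ?cs \<Longrightarrow> c \<bullet> v = 0"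
  \<comment> \<open>The lower part of \<open>v\<close> is a polynomial P(x) = E(x^2) + x O'(x^2)
    with coefficients \<open>d\<close>; the upper part is the polynomial \<open>Q\<close>.\<close>
  define d where "d t = v $ (n + t)" for t
  define E where "E x = (\<Sum>m<n. d (2 * m) * x ^ m)" for x
  define O' where "O' x = (\<Sum>m<n. d (2 * m + 1) * x ^ m)" for x
  define Q where "Q x = (\<Sum>m<n. v $ m * x ^ m)" for x
  have split: "(\<Sum>t<2 * n. x ^ t * v $ (n + t)) = E (x\<^sup>2) + x * O' (x\<^sup>2)" for x
    using sum_even_odd_split[of d x n] by (simp add: d_def E_def O'_def mult.commute)
  have v': "v \<in> carrier_vec (n + 2 * n)" using v by simp
  have p: "E ((of_nat (a s))\<^sup>2) - of_nat (a s) * O' ((of_nat (a s))\<^sup>2) = 0"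
    and qp: "Q ((of_nat (a s))\<^sup>2) + (E (- (of_nat (a s))\<^sup>2) + \<i> * of_nat (a s) * O' (- (of_nat (a s))\<^sup>2)) = 0"
    and qm: "Q ((of_nat (a s))\<^sup>2) + (E (- (of_nat (a s))\<^sup>2) - \<i> * of_nat (a s) * O' (- (of_nat (a s))\<^sup>2)) = 0"
    if s: "s \<in> {1..n}" for s
  proof -
    have s': "s \<in> set [1..<n + 1]" using s by (simp del: upt_Suc)
    have Q: "(\<Sum>m<n. of_nat (a s) ^ (2 * m) * v $ m) = Q ((of_nat (a s))\<^sup>2)"
      by (simp add: Q_def power_mult mult.commute[of _ "v $ _"])
    have "p_col n (a s) \<bullet> v = 0" "q_plus_col n 0 (a s) \<bullet> v = 0" "q_minus_col n 0 (a s) \<bullet> v = 0"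
      using s' by (auto intro!: orth simp del: upt_Suc set_upt)
    then show "E ((of_nat (a s))\<^sup>2) - of_nat (a s) * O' ((of_nat (a s))\<^sup>2) = 0"
      and "Q ((of_nat (a s))\<^sup>2) + (E (- (of_nat (a s))\<^sup>2) + \<i> * of_nat (a s) * O' (- (of_nat (a s))\<^sup>2)) = 0"
      and "Q ((of_nat (a s))\<^sup>2) + (E (- (of_nat (a s))\<^sup>2) - \<i> * of_nat (a s) * O' (- (of_nat (a s))\<^sup>2)) = 0"
      unfolding p_col_def q_plus_col_def q_minus_col_def append_vec_scalar_prod[OF v'] split
      by (simp_all add: Q power_mult_distrib)
  qed
  have O0: "d (2 * m + 1) = 0" if "m < n" for m
  proof (rule coeff_eq_0_if_roots_neg_squares[OF _ that])
    fix s assume s: "s \<in> {1..n}"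
    \<comment> \<open>Subtracting the two \<open>q\<close> conditions cancels \<open>Q\<close> and
      \<open>E\<close>; positivity of \<open>a s\<close> then allows division by it.\<close>
    have "2 * (\<i> * of_nat (a s) * O' (- (of_nat (a s))\<^sup>2)) = 0"
      using arg_cong2[OF qp[OF s] qm[OF s], of minus] by simp
    then show "(\<Sum>m<n. d (2 * m + 1) * (- (of_nat (a s))\<^sup>2) ^ m) = 0"
      using pos[OF s] by (simp add: O'_def)
  qed
  then have O: "O' x = 0" for x by (simp add: O'_def)
  have E0: "d (2 * m) = 0" if "m < n" for m
    using coeff_eq_0_if_roots_squares[of "\<lambda>m. d (2 * m)", OF _ that] p O by (simp add: E_def)
  then have E: "E x = 0" for x by (simp add: E_def)
  have Q0: "v $ m = 0" if "m < n" for m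
    using coeff_eq_0_if_roots_squares[of "\<lambda>m. v $ m", OF _ that] qp O E by (simp add: Q_def)
  have d0: "d t = 0" if "t < 2 * n" for t
  proof (cases "even t")
    case True then show ?thesis using E0[of "t div 2"] that by auto
  next
    case False then show ?thesis using O0[of "t div 2"] that by auto
  qed
  have "v $ i = 0" if "i < 3 * n" for i
    using Q0[of i] d0[of "i - n"] that by (cases "i < n") (auto simp: d_def)
  then show "v = 0\<^sub>v (3 * n)" using v by (intro eq_vecI) auto
qed

text \<open>Conjugating the diagonal matrix of signs by the invertible matrix \<open>U\<close> of
  even Vandermonde columns makes these columns eigenvectors with the prescribed signs.\<close>

lemma exists_sign_involution:
  fixes e :: "nat \<Rightarrow> complex"
  assumes e: "\<And>s. e s * e s = 1"
  obtains A where "A \<in> carrier_mat n n" "det A \<in> {1, -1}"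
    "\<And>s. s \<in> {1..n} \<Longrightarrow> A *\<^sub>v even_power_vec n (a s) = e s \<cdot>\<^sub>v even_power_vec n (a s)"
proof -
  let ?us = "map (\<lambda>s. even_power_vec n (a s)) [1..<n + 1]"
  define U where "U = mat_of_cols n ?us"
  \<comment> \<open>The shift reconciles matrix indices, which start at 0, with the indices
    \<open>s\<close> from 1 to \<open>n\<close>.\<close>
  define D where "D = mat_diag n (\<lambda>j. e (j + 1))"
  have U: "U \<in> carrier_mat n n" by (simp add: U_def carrier_matI del: upt_Suc)
  have D: "D \<in> carrier_mat n n" by (auto simp: D_def)
  \<comment> \<open>The inverse is read off from the units of the matrix ring; \<open>()\<close>
    fills the extension slot of that record.\<close>
  obtain V where V: "V \<in> carrier_mat n n" "U * V = 1\<^sub>m n" "V * U = 1\<^sub>m n"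
    using det_non_zero_imp_unit[OF U, of "()"] det_even_power_mat_neq_0
    by (auto simp: U_def Units_def ring_mat_def)
  define A where "A = U * D * V"
  have A: "A \<in> carrier_mat n n" using U D V by (auto simp: A_def)
  have DD: "D * D = 1\<^sub>m n" by (simp add: D_def mat_diag_diag e)
  have AU: "A * U = U * D"
    using U D V by (simp add: A_def assoc_mult_mat[of _ n n _ n _ n])
  \<comment> \<open>Only the square is computed: its factors regroup into determinants of
    \<open>U * V\<close> and \<open>D * D\<close>, both identity matrices.\<close>
  have "det A * det A = (det U * det V) * (det D * det D) * (det U * det V)"
    using U D V by (simp add: A_def det_mult[of _ n])
  also have "\<dots> = det (U * V) * det (D * D) * det (U * V)"
    by (simp only: det_mult[OF U V(1)] det_mult[OF D D])
  also have "\<dots> = 1" by (simp add: V DD)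
  finally have "det A \<in> {1, -1}" by (simp add: square_eq_1_iff)
  moreover have "A *\<^sub>v even_power_vec n (a s) = e s \<cdot>\<^sub>v even_power_vec n (a s)"
    if s: "s \<in> {1..n}" for s
  proof -
    have j: "s - 1 < n" using s by auto
    have us: "?us ! (s - 1) = even_power_vec n (a s)" using s
      by (subst nth_map) (auto simp: nth_upt simp del: upt_Suc)
    have colU: "col U (s - 1) = even_power_vec n (a s)"
      unfolding U_def using j us by (subst col_mat_of_cols) (auto simp del: upt_Suc)
    have "A *\<^sub>v even_power_vec n (a s) = col (A * U) (s - 1)"
      using col_mult2[OF A U j] colU by simp
    also have "\<dots> = col (U * D) (s - 1)" by (simp add: AU)
    also have "\<dots> = e s \<cdot>\<^sub>v col U (s - 1)"
      using U j s by (intro eq_vecI) (auto simp: D_def mat_diag_mult_right)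
    finally show ?thesis unfolding colU .
  qed
  ultimately show ?thesis using that A by blast
qed

lemma det_Delta2_mat_eq_up_to_sign:
  "det (Delta2_mat n a k) = det (Delta2_mat n a 0) \<or> det (Delta2_mat n a k) = - det (Delta2_mat n a 0)"
proof -
  have sq: "(-1) ^ (k * a s) * (-1) ^ (k * a s) = (1 :: complex)" for s
    by (simp flip: power_mult_distrib)
  obtain A where A: "A \<in> carrier_mat n n" and detA: "det A \<in> {1, -1}"
    and Au: "\<And>s. s \<in> {1..n} \<Longrightarrow>
      A *\<^sub>v even_power_vec n (a s) = (-1) ^ (k * a s) \<cdot>\<^sub>v even_power_vec n (a s)"
    by (rule exists_sign_involution[of "\<lambda>s. (-1) ^ (k * a s)", OF sq]) blast
  define T where "T = four_block_mat A (0\<^sub>m n (2 * n)) (0\<^sub>m (2 * n) n) (1\<^sub>m (2 * n))"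
  have "n + 2 * n = 3 * n" by simp
  then have T: "T \<in> carrier_mat (3 * n) (3 * n)"
    unfolding T_def using A by (metis four_block_carrier_mat one_carrier_mat)
  have detT: "det T = det A"
    unfolding T_def using A by (subst det_four_block_mat_lower_left_zero) auto
  have Tv: "T *\<^sub>v (u @\<^sub>v vec (2 * n) f) = (A *\<^sub>v u) @\<^sub>v vec (2 * n) f"
    if "u \<in> carrier_vec n" for u f
    unfolding T_def using A that by (subst mult_mat_vec_split) auto
  have A0: "A *\<^sub>v 0\<^sub>v n = 0\<^sub>v n" using A by auto
  \<comment> \<open>\<open>T\<close> keeps all lower blocks. \<open>A\<close> fixes the zero upper
    block of \<open>p_col\<close>, and since the sign for 0 is 1, it gives the \<open>q\<close>
    columns exactly the sign for \<open>k\<close>.\<close>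
  have T_cols: "T *\<^sub>v p_col n (a s) = p_col n (a s)"
    "T *\<^sub>v q_plus_col n 0 (a s) = q_plus_col n k (a s)"
    "T *\<^sub>v q_minus_col n 0 (a s) = q_minus_col n k (a s)" if "s \<in> {1..n}" for s
    unfolding p_col_alt q_plus_col_alt q_minus_col_alt
    by (subst Tv; simp add: A0 Au[OF that])+
  have "T * Delta2_mat n a 0 = Delta2_mat n a k"
    unfolding Delta2_mat_def
    by (subst mult_mat_of_cols[OF T])
      (auto simp: columns_carrier T_cols map_concat o_def simp del: upt_Suc
        intro!: arg_cong[of _ _ "mat_of_cols _"] arg_cong[of _ _ concat])
  then have "det (Delta2_mat n a k) = det A * det (Delta2_mat n a 0)"
    using det_mult[OF T Delta2_mat_carrier] detT by metis
  then show ?thesis using detA by auto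
qed

end

theorem mainTheorem3:
  fixes n :: nat and a :: "nat \<Rightarrow> nat"
  assumes "n \<ge> 1"
    and "\<And>s. s \<in> {1..n} \<Longrightarrow> a s \<ge> 1"
    and "strict_mono_on {1..n} a"
  shows "\<exists>C::complex. C \<noteq> 0 \<and> (\<forall>k::nat. k \<ge> 1 \<longrightarrow> Delta2 n a k \<in> {C, - C})"
proof (intro exI conjI allI impI)
  have inj: "inj_on a {1..n}"
    using assms(3) by (rule strict_mono_on_imp_inj_on)
  \<comment> \<open>This fixes the witness \<open>C\<close> as the value at
    \<open>k = 0\<close>.\<close>
  show "Delta2 n a 0 \<noteq> 0"
    unfolding Delta2_def using det_Delta2_mat_0_neq_0[OF assms(2) inj] by simp
  show "Delta2 n a k \<in> {Delta2 n a 0, - Delta2 n a 0}" for k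
    unfolding Delta2_def using det_Delta2_mat_eq_up_to_sign[OF assms(2) inj, of k] by auto
qed

end
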